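(* Let $k\ge1$ be an integer, let $\Sigma$ be a finite alphabet, and let $\Gamma\subseteq\mathcal{P}(\Sigma^k)$ be a one-dimensional semiconstrained system. Then for all integers $d\ge1$, $$h_{\mathrm{ind}}(\Gamma^{\otimes d})=h_{\mathrm{ind}}(\Gamma),$$ where $h_{\mathrm{ind}}$ is the independence entropy and $\Gamma^{\otimes d}$ is the $d$-axial-product semiconstrained system of $\Gamma$.
   Context: Notation: $[n]=\{0,1,\dots,n-1\}$; $F_n^d=[n]^d\subset\mathbb{Z}^d$; $\mathbf{e}_i$ ($i\in[d]$) is the $i$-th unit vector; $[k]\mathbf{e}_i=\{0,\mathbf{e}_i,\dots,(k-1)\mathbf{e}_i\}$; $\Sigma^k=\Sigma^{[k]}$. $\mathcal{P}(X)$ is the set of probability measures on $X$. For $S\subseteq\tilde S$ and $\mu\in\mathcal{P}(\Sigma^{\tilde S})$, $\pi_S(\mu)\in\mathcal{P}(\Sigma^S)$ is the $S$-marginal. Marginals on $[k]\mathbf{e}_i$, and on translates $S+\mathbf{v}$, are identified with measures on $\Sigma^k$, respectively $\Sigma^S$, in the obvious way. $\|\mu-\nu\|_{TV}=\sup_W|\mu(W)-\nu(W)|$. A ($\mathbb{Z}^d$-)semiconstrained system (SCS) is a set $\Gamma\subseteq\mathcal{P}(\Sigma^S)$ for a finite $S\subseteq\mathbb{Z}^d$ (one-dimensional: $S=[k]$). For $\epsilon>0$, $\mathbb{B}_\epsilon(\Gamma)=\{\mu\in\mathcal{P}(\Sigma^S): \inf_{\nu\in\Gamma}\|\mu-\nu\|_{TV}\le\epsilon\}$.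 Independence entropy, for $\Gamma\subseteq\mathcal{P}(\Sigma^S)$ with $S\subseteq F_k^d$: for $n\ge k$ and $\mu\in\mathcal{P}(\Sigma^{F_n^d})$ let $\overline{\pi}_S(\mu)=\frac1{n^d}\sum_{\mathbf v\in F_n^d}\pi_{S+\mathbf v}(\mu)$, coordinates of $S+\mathbf v$ being taken modulo $n$. Let $\overline{\mathcal{P}}_n(\Gamma)$ be the set of product measures $\mu=\prod_{\mathbf v\in F_n^d}p_{\mathbf v}$, $p_{\mathbf v}\in\mathcal{P}(\Sigma)$, on $\Sigma^{F_n^d}$ with $\overline{\pi}_S(\mu)\in\Gamma$. With $H(\mu)=-\sum_w\mu(w)\log_2\mu(w)$, set $\widehat{h_{\mathrm{ind}}}(\Gamma)=\limsup_{n\to\infty}\sup_{\mu\in\overline{\mathcal{P}}_n(\Gamma)}\frac1{n^d}H(\mu)$ and $h_{\mathrm{ind}}(\Gamma)=\lim_{\epsilon\to0^+}\widehat{h_{\mathrm{ind}}}(\mathbb{B}_\epsilon(\Gamma))$. Convention: $\sup\emptyset=-\infty$. Axial product: for $\Gamma\subseteq\mathcal{P}(\Sigma^k)$ let $S=\bigcup_{i\in[d]}[k]\mathbf{e}_i\subseteq F_k^d$ and $\Gamma^{\otimes d}=\{\mu\in\mathcal{P}(\Sigma^S):\ \pi_{[k]\mathbf{e}_i}(\mu)\in\Gamma\text{ for all }i\in[d]\}$. *)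

theory Defs
  imports "HOL-Probability.Probability"
begin

text \<open>
  A point of \<open>\<int>\<^sup>d\<close> is a function \<open>v :: nat \<Rightarrow> int\<close> with \<open>v i = 0\<close> for all \<open>i \<ge> d\<close>.  Thus
  \<open>\<int>\<^sup>1\<close> is the first coordinate axis, and a one-dimensional system with window
  \<open>[k] = {0,\<dots>,k-1}\<close> is a system with window \<open>cube 1 k\<close>.
\<close>

type_synonym point = "nat \<Rightarrow> int"

definition cube :: "nat \<Rightarrow> nat \<Rightarrow> point set" where
  "cube d n = PiE_dflt {..<d} 0 (\<lambda>_. {0..<int n})"

definition axis_point :: "nat \<Rightarrow> int \<Rightarrow> point" where
  "axis_point i j = (\<lambda>l. if l = i then j else 0)"

definition shift_mod :: "nat \<Rightarrow> point \<Rightarrow> point \<Rightarrow> point" where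
  "shift_mod n v s = (\<lambda>i. (s i + v i) mod int n)"


text \<open>
  Configurations in \<open>\<Sigma>\<^sup>S\<close> are functions on \<open>S\<close> that are \<^const>\<open>undefined\<close> outside \<open>S\<close>; the
  alphabet is a finite type.  For finite \<open>S\<close> there are finitely many of them, so every
  probability measure on \<open>\<Sigma>\<^sup>S\<close> is a pmf.
\<close>

definition measures_on :: "'s set \<Rightarrow> ('s \<Rightarrow> 'a::finite) pmf set" where
  "measures_on S = {\<mu>. set_pmf \<mu> \<subseteq> (S \<rightarrow>\<^sub>E UNIV)}"

text \<open>
  For \<open>f\<close> injective on \<open>T\<close>, this is the marginal of \<open>\<mu>\<close> on \<open>f ` T\<close>, regarded as a measure on
  \<open>\<Sigma>\<^sup>T\<close> through the bijection \<open>f : T \<rightarrow> f ` T\<close>.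
\<close>

definition marginal_along ::
    "('t \<Rightarrow> 's) \<Rightarrow> 't set \<Rightarrow> ('s \<Rightarrow> 'a) pmf \<Rightarrow> ('t \<Rightarrow> 'a) pmf" where
  "marginal_along f T \<mu> = map_pmf (\<lambda>w. restrict (w \<circ> f) T) \<mu>"

definition tv_dist :: "'b pmf \<Rightarrow> 'b pmf \<Rightarrow> real" where
  "tv_dist \<mu> \<nu> = (SUP W. \<bar>measure_pmf.prob \<mu> W - measure_pmf.prob \<nu> W\<bar>)"

text \<open>The infimum is taken in \<^typ>\<open>ereal\<close>, so that neighbourhoods of \<open>{}\<close> are empty.\<close>

definition tv_nbhd ::
    "real \<Rightarrow> 's set \<Rightarrow> ('s \<Rightarrow> 'a::finite) pmf set \<Rightarrow> ('s \<Rightarrow> 'a) pmf set" where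
  "tv_nbhd \<epsilon> S \<Gamma> = {\<mu> \<in> measures_on S. (INF \<nu>\<in>\<Gamma>. ereal (tv_dist \<mu> \<nu>)) \<le> ereal \<epsilon>}"

definition shannon :: "'b pmf \<Rightarrow> real" where
  "shannon \<mu> = - (\<Sum>w\<in>set_pmf \<mu>. pmf \<mu> w * log 2 (pmf \<mu> w))"


text \<open>
  Drawing the translation vector uniformly from \<open>cube d n\<close> averages the marginals; see
  \<open>pmf_mean_marginal\<close> below.
\<close>

definition mean_marginal ::
    "nat \<Rightarrow> nat \<Rightarrow> point set \<Rightarrow> (point \<Rightarrow> 'a) pmf \<Rightarrow> (point \<Rightarrow> 'a) pmf" where
  "mean_marginal d n S \<mu> =
     bind_pmf (pmf_of_set (cube d n)) (\<lambda>v. marginal_along (shift_mod n v) S \<mu>)"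

definition product_measures ::
    "nat \<Rightarrow> nat \<Rightarrow> point set \<Rightarrow> (point \<Rightarrow> 'a::finite) pmf set \<Rightarrow> (point \<Rightarrow> 'a) pmf set" where
  "product_measures d n S \<Gamma> =
     {\<mu>. (\<exists>p. \<mu> = Pi_pmf (cube d n) undefined p) \<and> mean_marginal d n S \<mu> \<in> \<Gamma>}"

text \<open>
  The window \<open>S\<close> is meant to lie in \<open>cube d k\<close> for some \<open>k\<close>; then \<open>shift_mod n v\<close> is injective
  on \<open>S\<close> for all \<open>n \<ge> k\<close>, and smaller \<open>n\<close> do not affect the upper limit.
\<close>

definition h_ind_hat ::
    "nat \<Rightarrow> point set \<Rightarrow> (point \<Rightarrow> 'a::finite) pmf set \<Rightarrow> ereal" where
  "h_ind_hat d S \<Gamma> =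
     limsup (\<lambda>n. SUP \<mu>\<in>product_measures d n S \<Gamma>. ereal (1 / real n ^ d * shannon \<mu>))"

definition h_ind ::
    "nat \<Rightarrow> point set \<Rightarrow> (point \<Rightarrow> 'a::finite) pmf set \<Rightarrow> ereal" where
  "h_ind d S \<Gamma> = Lim (at_right 0) (\<lambda>\<epsilon>. h_ind_hat d S (tv_nbhd \<epsilon> S \<Gamma>))"


definition axial_window :: "nat \<Rightarrow> nat \<Rightarrow> point set" where
  "axial_window d k = (\<Union>i<d. axis_point i ` {0..<int k})"

text \<open>
  The map \<open>\<lambda>s. axis_point i (s 0)\<close> identifies \<open>cube 1 k\<close> with the segment of length \<open>k\<close> on the
  \<open>i\<close>-th axis.
\<close>

definition axial_product ::
    "nat \<Rightarrow> nat \<Rightarrow> (point \<Rightarrow> 'a::finite) pmf set \<Rightarrow> (point \<Rightarrow> 'a) pmf set" where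
  "axial_product d k \<Gamma> =
     {\<mu> \<in> measures_on (axial_window d k).
        \<forall>i<d. marginal_along (\<lambda>s. axis_point i (s 0)) (cube 1 k) \<mu> \<in> \<Gamma>}"


lemma finite_cube: "finite (cube d n)"
  unfolding cube_def by (intro finite_PiE_dflt) auto

lemma card_cube: "card (cube d n) = n ^ d"
  unfolding cube_def by (subst card_PiE_dflt) auto

lemma pmf_mean_marginal:
  assumes "n \<ge> 1"
  shows "pmf (mean_marginal d n S \<mu>) w =
    1 / real n ^ d * (\<Sum>v\<in>cube d n. pmf (marginal_along (shift_mod n v) S \<mu>) w)"
proof -
  have "cube d n \<noteq> {}"
    using assms card_cube[of d n] by (metis card.empty not_one_le_zero power_not_zero)
  then show ?thesis
    unfolding mean_marginal_def
    by (simp add: pmf_bind_pmf_of_set finite_cube card_cube)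
qed

lemma axis_point_cube_1: "axis_point 0 ` {0..<int k} = cube 1 k"
proof
  show "cube 1 k \<subseteq> axis_point 0 ` {0..<int k}"
  proof
    fix s assume s: "s \<in> cube 1 k"
    then have "s = axis_point 0 (s 0)"
      by (auto simp: cube_def PiE_dflt_def axis_point_def)
    moreover have "s 0 \<in> {0..<int k}"
      using s by (auto simp: cube_def PiE_dflt_def)
    ultimately show "s \<in> axis_point 0 ` {0..<int k}" by blast
  qed
qed (auto simp: cube_def PiE_dflt_def axis_point_def)

lemma h_ind_hat_mono:
  assumes "\<Gamma> \<subseteq> \<Delta>"
  shows "h_ind_hat d S \<Gamma> \<le> h_ind_hat d S \<Delta>"
  unfolding h_ind_hat_def
  using assms by (intro Limsup_mono always_eventually allI SUP_subset_mono)
    (auto simp: product_measures_def)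

lemma tv_nbhd_mono: "\<epsilon> \<le> \<delta> \<Longrightarrow> tv_nbhd \<epsilon> S \<Gamma> \<subseteq> tv_nbhd \<delta> S \<Gamma>"
  unfolding tv_nbhd_def by (auto intro: order_trans)

text \<open>The limit defining \<^const>\<open>h_ind\<close> always exists.\<close>

lemma tendsto_h_ind:
  "((\<lambda>\<epsilon>. h_ind_hat d S (tv_nbhd \<epsilon> S \<Gamma>)) \<longlongrightarrow> h_ind d S \<Gamma>) (at_right 0)"
proof -
  let ?f = "\<lambda>\<epsilon>. h_ind_hat d S (tv_nbhd \<epsilon> S \<Gamma>)"
  let ?L = "INF \<epsilon>\<in>{0<..}. ?f \<epsilon>"
  have mono: "?f \<epsilon> \<le> ?f \<delta>" if "\<epsilon> \<le> \<delta>" for \<epsilon> \<delta>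
    using that by (intro h_ind_hat_mono tv_nbhd_mono)
  have "(?f \<longlongrightarrow> ?L) (at_right 0)"
  proof (rule order_tendstoI)
    fix a assume a: "a < ?L"
    have "a < ?f \<epsilon>" if "\<epsilon> > 0" for \<epsilon>
      using a that by (meson INF_lower greaterThan_iff less_le_trans)
    then show "eventually (\<lambda>\<epsilon>. a < ?f \<epsilon>) (at_right 0)"
      by (auto simp: eventually_at_right_field intro!: exI[of _ 1])
  next
    fix a assume "?L < a"
    then obtain \<delta> where "\<delta> > 0" "?f \<delta> < a"
      by (auto simp: INF_less_iff)
    then show "eventually (\<lambda>\<epsilon>. ?f \<epsilon> < a) (at_right 0)"
      using mono by (auto simp: eventually_at_right_field intro!: exI[of _ \<delta>]
        elim: le_less_trans[rotated])
  qed
  then show ?thesis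
    unfolding h_ind_def using tendsto_Lim trivial_limit_at_right_real by metis
qed

end

theory Submission
  imports Defs
begin

text \<open>
  Both inequalities compare product measures of equal entropy per site, and both only use the
  letter distributions \<open>p\<close> of such a measure: the site entropies add up, so the entropy per site is
  the mean of the entropy of \<open>p v\<close> over a uniformly chosen site \<open>v\<close>
  (\<open>entropy_rate_Pi_pmf\<close>).  Hence substituting \<open>p \<circ> \<sigma>\<close> for \<open>p\<close> keeps the rate
  whenever \<open>\<sigma>\<close> carries the uniform distribution on one torus to that on another.

  For \<open>h_ind(\<Gamma>) \<le> h_ind(\<Gamma>\<^sup>\<otimes>\<^sup>d)\<close>, a product measure on a cycle of length \<open>n\<close> is spread along diagonals
  by \<open>\<sigma> v = (\<Sum>l. v l) mod n\<close>.  A unit step in any direction moves \<open>\<sigma> v\<close> one step along the cycle,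
  so every axis marginal of the new mean marginal is the old one-dimensional mean marginal \<open>\<nu>\<close>.
  It remains to see that, if \<open>\<nu>\<close> is close to some \<open>\<nu>'\<close> in \<open>\<Gamma>\<close>, the mean marginal on the
  cross-shaped window is close to a measure all of whose axis marginals equal \<open>\<nu>'\<close>, which
  therefore lies in the axial product.  This is \<open>exists_near_pmf_with_axis_marginals\<close>, the main
  step.  It keeps from the given measure a part whose axis marginals are dominated by \<open>\<nu>'\<close>; the masses still missing on the various axes induce
  the same distribution of the letter at the origin, the only site that the axes share, so they can
  be filled in by one measure that is conditionally independent given that letter.

  For \<open>h_ind(\<Gamma>\<^sup>\<otimes>\<^sup>d) \<le> h_ind(\<Gamma>)\<close>, the torus of side \<open>n\<close> is cut into its lines in direction \<open>0\<close>, and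
  the lines are concatenated to a cycle of length \<open>n\<^sup>d\<close>, by reading a position in base \<open>n\<close>.  A
  window of length \<open>k\<close> is affected only if it starts among the last \<open>k - 1\<close> sites of a line, so the
  one-dimensional mean marginal is within \<open>k / n\<close> of the axis-\<open>0\<close> marginal of the given mean
  marginal, and the latter is close to \<open>\<Gamma>\<close>.

  In both cases a neighbourhood of radius \<open>\<epsilon>\<close> is replaced by one whose radius is a fixed multiple
  of \<open>\<epsilon>\<close>, which the limit \<open>\<epsilon> \<rightarrow> 0\<close> absorbs.
\<close>

section \<open>Total variation distance\<close>

lemma abs_prob_diff_le_tv_dist:
  "\<bar>measure_pmf.prob \<mu> W - measure_pmf.prob \<nu> W\<bar> \<le> tv_dist \<mu> \<nu>"
proof -
  have "\<bar>measure_pmf.prob \<mu> V - measure_pmf.prob \<nu> V\<bar> \<le> 1" for V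
    using measure_pmf.prob_le_1[of \<mu> V] measure_pmf.prob_le_1[of \<nu> V]
      measure_nonneg[of \<mu> V] measure_nonneg[of \<nu> V] by linarith
  then show ?thesis
    unfolding tv_dist_def by (intro cSUP_upper bdd_aboveI[of _ 1]) auto
qed

lemma tv_dist_leI:
  assumes "\<And>W. \<bar>measure_pmf.prob \<mu> W - measure_pmf.prob \<nu> W\<bar> \<le> c"
  shows "tv_dist \<mu> \<nu> \<le> c"
  unfolding tv_dist_def using assms by (intro cSUP_least) auto

lemma tv_dist_triangle: "tv_dist \<mu> \<nu> \<le> tv_dist \<mu> \<rho> + tv_dist \<rho> \<nu>"
proof (rule tv_dist_leI)
  fix W
  show "\<bar>measure_pmf.prob \<mu> W - measure_pmf.prob \<nu> W\<bar> \<le> tv_dist \<mu> \<rho> + tv_dist \<rho> \<nu>"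
    using abs_prob_diff_le_tv_dist[of \<mu> W \<rho>] abs_prob_diff_le_tv_dist[of \<rho> W \<nu>]
    by linarith
qed

lemma tv_dist_map_le: "tv_dist (map_pmf f \<mu>) (map_pmf f \<nu>) \<le> tv_dist \<mu> \<nu>"
  by (intro tv_dist_leI) (auto simp: abs_prob_diff_le_tv_dist)

text \<open>
  Two experiments that share their first stage can differ only if that stage ends in \<open>B\<close>.
\<close>

lemma tv_dist_bind_le:
  fixes K K' :: "'a \<Rightarrow> 'b pmf"
  assumes "\<And>x. x \<in> set_pmf M \<Longrightarrow> x \<notin> B \<Longrightarrow> K x = K' x"
  shows "tv_dist (bind_pmf M K) (bind_pmf M K') \<le> measure_pmf.prob M B"
proof (rule tv_dist_leI)
  fix W
  have bnd: "measure_pmf.prob (bind_pmf M L) W = (\<integral>x. measure_pmf.prob (L x) W \<partial>M)"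
    for L :: "'a \<Rightarrow> 'b pmf"
    by (subst measure_pmf_bind, subst measure_pmf.measure_bind[where N="count_space UNIV"])
      (auto simp: measure_pmf_in_subprob_algebra)
  have int: "integrable (measure_pmf M) (\<lambda>x. measure_pmf.prob (L x) W)" for L :: "'a \<Rightarrow> 'b pmf"
    by (rule measure_pmf.integrable_const_bound[where B=1]) auto
  have le1: "\<bar>measure_pmf.prob (K x) W - measure_pmf.prob (K' x) W\<bar> \<le> 1" for x
          using measure_pmf.prob_le_1[of "K x" W] measure_pmf.prob_le_1[of "K' x" W]
            measure_nonneg[of "K x" W] measure_nonneg[of "K' x" W]
          by linarith
  have "\<bar>measure_pmf.prob (bind_pmf M K) W - measure_pmf.prob (bind_pmf M K') W\<bar>
      = \<bar>\<integral>x. measure_pmf.prob (K x) W - measure_pmf.prob (K' x) W \<partial>M\<bar>"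
    by (simp add: bnd int)
  also have "\<dots> \<le> (\<integral>x. \<bar>measure_pmf.prob (K x) W - measure_pmf.prob (K' x) W\<bar> \<partial>M)"
    using integral_norm_bound[of "measure_pmf M"
      "\<lambda>x. measure_pmf.prob (K x) W - measure_pmf.prob (K' x) W"] by simp
  also have "\<dots> \<le> (\<integral>x. indicator B x \<partial>M)"
  proof (rule integral_mono_AE)
    show "AE x in M. \<bar>measure_pmf.prob (K x) W - measure_pmf.prob (K' x) W\<bar> \<le> indicator B x"
    proof (rule AE_pmfI)
      fix x assume x: "x \<in> set_pmf M"
      show "\<bar>measure_pmf.prob (K x) W - measure_pmf.prob (K' x) W\<bar> \<le> indicator B x"
      proof (cases "x \<in> B")
        case True
        then show ?thesis using le1[of x] by simp
      qed (use assms[OF x] in simp)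
    qed
  qed (auto simp: le1 intro!: integrable_abs Bochner_Integration.integrable_diff int measure_pmf.integrable_const_bound[where B=1])
  finally show "\<bar>measure_pmf.prob (bind_pmf M K) W - measure_pmf.prob (bind_pmf M K') W\<bar>
      \<le> measure_pmf.prob M B" by simp
qed

section \<open>Correcting the marginals of a measure\<close>

lemma exists_pmf_on_finite:
  fixes f :: "'b \<Rightarrow> real"
  assumes "finite A" "\<And>x. 0 \<le> f x" "\<And>x. x \<notin> A \<Longrightarrow> f x = 0" "sum f A = 1"
  shows "\<exists>p. \<forall>x. pmf p x = f x"
proof -
  have "(\<integral>\<^sup>+x. ennreal (f x) \<partial>count_space UNIV) = (\<Sum>x\<in>A. ennreal (f x))"
    using assms by (intro nn_integral_count_space'[OF assms(1)]) auto
  also have "\<dots> = 1"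
    using assms by (simp add: sum_ennreal)
  finally show ?thesis
    using assms(2) by (intro exI[of _ "embed_pmf f"]) (simp add: pmf_embed_pmf)
qed

lemma prob_eq_sum:
  assumes "finite A" "set_pmf p \<subseteq> A"
  shows "measure_pmf.prob p W = (\<Sum>x\<in>A. if x \<in> W then pmf p x else 0)"
proof -
  have "measure_pmf.prob p W = measure_pmf.prob p (A \<inter> W)"
    using assms by (intro measure_pmf.finite_measure_eq_AE) (auto simp: AE_measure_pmf_iff)
  also have "\<dots> = (\<Sum>x\<in>A \<inter> W. pmf p x)"
    using assms by (intro measure_measure_pmf_finite) auto
  finally show ?thesis
    using assms by (simp add: sum.inter_restrict)
qed

lemma pmf_map_eq_sum:
  assumes "finite A" "set_pmf p \<subseteq> A"
  shows "pmf (map_pmf m p) x = (\<Sum>w\<in>A. if m w = x then pmf p w else 0)"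
  using prob_eq_sum[OF assms, of "m -` {x}"] by (simp add: pmf_map)

text \<open>
  A measure \<open>\<mu>\<close> whose marginals \<open>m i\<close> all equal \<open>\<nu>\<close> is modified so that they all become \<open>\<nu>'\<close>, at a
  cost proportional to the distance of \<open>\<nu>\<close> and \<open>\<nu>'\<close>.  Keep an outcome \<open>w\<close> with probability
  \<open>\<Prod>i. f (m i w)\<close>, where \<open>f = min 1 (\<nu>' / \<nu>)\<close>.  One factor \<open>f\<close> already pushes \<open>\<nu>\<close> below \<open>\<nu>'\<close>, so
  the kept part has all marginals below \<open>\<nu>'\<close>; and each factor loses only the mass by which \<open>\<nu>\<close>
  exceeds \<open>\<nu>'\<close>, so at most \<open>card I\<close> times the distance is lost.

  The defects of the marginals must then be realised jointly.  The marginals overlap in a common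
  part, read off by \<open>base\<close>.  On it all defects agree, because each is the same measure
  \<open>map base \<nu>'\<close> minus the image of the same kept part.  Assumption \<open>glue\<close> says that agreement on the
  common part is the only obstruction to a joint realisation.
\<close>

lemma exists_pmf_with_marginals_near:
  fixes \<mu> :: "'w pmf" and m :: "'i \<Rightarrow> 'w \<Rightarrow> 'x" and base :: "'x \<Rightarrow> 'c"
  assumes I: "finite I" and A: "finite A" "set_pmf \<mu> \<subseteq> A" and X: "finite X"
    and nu: "set_pmf \<nu> \<subseteq> X" and nu': "set_pmf \<nu>' \<subseteq> X"
    and mX: "\<And>i w. i \<in> I \<Longrightarrow> w \<in> A \<Longrightarrow> m i w \<in> X"
    and marg: "\<And>i. i \<in> I \<Longrightarrow> map_pmf (m i) \<mu> = \<nu>"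
    and orig: "\<And>i w. i \<in> I \<Longrightarrow> w \<in> A \<Longrightarrow> base (m i w) = base0 w"
    and glue: "\<And>r q. \<lbrakk>\<And>i. i \<in> I \<Longrightarrow> set_pmf (r i) \<subseteq> X \<and> map_pmf base (r i) = q\<rbrakk> \<Longrightarrow>
        \<exists>\<rho>. set_pmf \<rho> \<subseteq> A \<and> (\<forall>i\<in>I. map_pmf (m i) \<rho> = r i)"
  shows "\<exists>\<mu>'. set_pmf \<mu>' \<subseteq> A \<and> (\<forall>i\<in>I. map_pmf (m i) \<mu>' = \<nu>') \<and>
      tv_dist \<mu> \<mu>' \<le> real (card I) * tv_dist \<nu> \<nu>'"
proof -
  define f where "f x = min 1 (pmf \<nu>' x / pmf \<nu> x)" for x
  have f01: "0 \<le> f x" "f x \<le> 1" for x by (auto simp: f_def)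
  have f_mult: "f x * pmf \<nu> x \<le> pmf \<nu>' x" for x
    by (cases "pmf \<nu> x = 0") (auto simp: f_def min_def field_simps)
  define g where "g w = (\<Prod>i\<in>I. f (m i w))" for w
  have g: "1 - g w \<le> (\<Sum>i\<in>I. 1 - f (m i w)) \<and> 0 \<le> g w \<and> g w \<le> 1" for w
    using Weierstrass_prod_ineq[of I "\<lambda>i. 1 - f (m i w)"] f01
    by (auto simp: g_def intro!: prod_nonneg prod_le_1)
  define u where "u w = pmf \<mu> w * g w" for w
  have u0: "0 \<le> u w" and u_le: "u w \<le> pmf \<mu> w" for w
    using g by (auto simp: u_def intro: mult_left_le)
  \<comment> \<open>the mass that is not kept\<close>
  define c where "c = 1 - sum u A"
  have mu1: "sum (pmf \<mu>) A = 1"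
    using A by (rule sum_pmf_eq_1)
  have c0: "0 \<le> c"
    unfolding c_def mu1[symmetric] using u_le by (simp add: sum_mono)
  have marg_sum: "(\<Sum>w\<in>A. pmf \<mu> w * h (m i w)) = (\<Sum>x\<in>X. pmf \<nu> x * h x)" if i: "i \<in> I"
    for i and h :: "'x \<Rightarrow> real"
  proof -
    have "(\<Sum>x\<in>X. pmf \<nu> x * h x) = (\<Sum>x\<in>X. \<Sum>w\<in>A. if m i w = x then pmf \<mu> w * h (m i w) else 0)"
      by (subst marg[OF i, symmetric])
        (auto simp: pmf_map_eq_sum[OF A] sum_distrib_right intro!: sum.cong)
    also have "\<dots> = (\<Sum>w\<in>A. \<Sum>x\<in>X. if m i w = x then pmf \<mu> w * h (m i w) else 0)"
      by (rule sum.swap)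
    also have "\<dots> = (\<Sum>w\<in>A. pmf \<mu> w * h (m i w))"
      using mX[OF i] X by (intro sum.cong) auto
    finally show ?thesis by simp
  qed
  have c_le: "c \<le> real (card I) * tv_dist \<nu> \<nu>'"
  proof -
    \<comment> \<open>the mass removed by one factor is the excess of \<open>\<nu>\<close> over \<open>\<nu>'\<close>, attained at an event\<close>
    have loss: "(\<Sum>x\<in>X. pmf \<nu> x * (1 - f x)) \<le> tv_dist \<nu> \<nu>'"
    proof -
      let ?W = "{x. pmf \<nu>' x < pmf \<nu> x}"
      have "pmf \<nu> x * (1 - f x) = (if x \<in> ?W then pmf \<nu> x else 0) - (if x \<in> ?W then pmf \<nu>' x else 0)" for x
        using pmf_nonneg[of \<nu> x] pmf_nonneg[of \<nu>' x] by (cases "pmf \<nu> x = 0") (auto simp: f_def min_def field_simps)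
      then have "(\<Sum>x\<in>X. pmf \<nu> x * (1 - f x)) = measure_pmf.prob \<nu> ?W - measure_pmf.prob \<nu>' ?W"
        by (simp add: prob_eq_sum[OF X nu] prob_eq_sum[OF X nu'] sum_subtractf)
      then show ?thesis using abs_prob_diff_le_tv_dist[of \<nu> ?W \<nu>'] by simp
    qed
    have "c = (\<Sum>w\<in>A. pmf \<mu> w * (1 - g w))"
      using mu1 by (simp add: c_def u_def sum_subtractf right_diff_distrib)
    also have "\<dots> \<le> (\<Sum>w\<in>A. pmf \<mu> w * (\<Sum>i\<in>I. 1 - f (m i w)))"
      using g by (intro sum_mono mult_left_mono) auto
    also have "\<dots> = (\<Sum>i\<in>I. \<Sum>w\<in>A. pmf \<mu> w * (1 - f (m i w)))"
      unfolding sum_distrib_left by (rule sum.swap)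
    also have "\<dots> = (\<Sum>i\<in>I. \<Sum>x\<in>X. pmf \<nu> x * (1 - f x))"
      using marg_sum[of _ "\<lambda>x. 1 - f x"] by (intro sum.cong) auto
    also have "\<dots> \<le> (\<Sum>i\<in>I. tv_dist \<nu> \<nu>')"
      using loss by (intro sum_mono)
    finally show ?thesis by simp
  qed
  \<comment> \<open>the defect of the \<open>i\<close>-th marginal of the kept part\<close>
  define res where "res i x = pmf \<nu>' x - (\<Sum>w\<in>A. if m i w = x then u w else 0)" for i x
  have res0: "0 \<le> res i x" if i: "i \<in> I" for i x
  proof -
    have "u w \<le> pmf \<mu> w * f (m i w)" for w
    proof -
      have "g w = f (m i w) * (\<Prod>j\<in>I - {i}. f (m j w))"
        unfolding g_def using I i by (rule prod.remove)
      also have "\<dots> \<le> f (m i w)"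
        using f01 by (intro mult_left_le prod_le_1) auto
      finally show ?thesis unfolding u_def by (intro mult_left_mono) auto
    qed
    then have "(\<Sum>w\<in>A. if m i w = x then u w else 0) \<le> (\<Sum>w\<in>A. (if m i w = x then pmf \<mu> w else 0) * f x)"
      by (intro sum_mono) auto
    also have "\<dots> = pmf \<nu> x * f x"
      unfolding marg[OF i, symmetric] pmf_map_eq_sum[OF A] sum_distrib_right ..
    finally show ?thesis using f_mult[of x] by (simp add: res_def mult.commute)
  qed
  have res_out: "res i x = 0" if "i \<in> I" "x \<notin> X" for i x
  proof -
    have "pmf \<nu>' x = 0" using that nu' by (auto simp: set_pmf_eq)
    moreover have "(\<Sum>w\<in>A. if m i w = x then u w else 0) = 0"
      using mX[OF that(1)] that(2) by (intro sum.neutral) auto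
    ultimately show ?thesis by (simp add: res_def)
  qed
  have res_sum: "sum (res i) X = c" if i: "i \<in> I" for i
  proof -
    have "(\<Sum>x\<in>X. \<Sum>w\<in>A. if m i w = x then u w else 0) = (\<Sum>w\<in>A. \<Sum>x\<in>X. if m i w = x then u w else 0)"
      by (rule sum.swap)
    also have "\<dots> = sum u A"
      using mX[OF i] X by (intro sum.cong) auto
    finally show ?thesis
      using sum_pmf_eq_1[OF X nu'] by (simp add: res_def c_def sum_subtractf)
  qed
  have "\<exists>\<rho>. set_pmf \<rho> \<subseteq> A \<and> (\<forall>i\<in>I. \<forall>x. c * pmf (map_pmf (m i) \<rho>) x = res i x)"
  \<comment> \<open>if nothing is lost, the defects vanish and any measure serves as the filling\<close>
  proof (cases "c = 0")
    case True
    have "res i x = 0" if i: "i \<in> I" for i x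
    proof (cases "x \<in> X")
      case x: True
      have "res i x \<le> sum (res i) X"
        using res0[OF i] X x by (intro member_le_sum) auto
      then show ?thesis using res0[OF i, of x] res_sum[OF i] True by simp
    qed (use res_out i in auto)
    then show ?thesis using A True by (intro exI[of _ \<mu>]) auto
  next
    case False
    have "\<exists>p. \<forall>x. pmf p x = res i x / c" if i: "i \<in> I" for i
      using res0[OF i] res_out[OF i] res_sum[OF i] c0 False X
      by (intro exists_pmf_on_finite[of X]) (auto simp: sum_divide_distrib[symmetric])
    then obtain r where r: "\<And>i x. i \<in> I \<Longrightarrow> pmf (r i) x = res i x / c" by metis
    have rX: "set_pmf (r i) \<subseteq> X" if "i \<in> I" for i
      using res_out[OF that] r[OF that] by (auto simp: set_pmf_eq)
    have r_orig: "pmf (map_pmf base (r i)) a =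
        (pmf (map_pmf base \<nu>') a - (\<Sum>w\<in>A. if base0 w = a then u w else 0)) / c" if i: "i \<in> I" for i a
    proof -
      have "(\<Sum>x\<in>X. if base x = a then \<Sum>w\<in>A. if m i w = x then u w else 0 else 0)
          = (\<Sum>x\<in>X. \<Sum>w\<in>A. if m i w = x then if base x = a then u w else 0 else 0)"
        by (intro sum.cong) (auto intro!: sum.neutral sum.cong)
      also have "\<dots> = (\<Sum>w\<in>A. \<Sum>x\<in>X. if m i w = x then if base x = a then u w else 0 else 0)"
        by (rule sum.swap)
      also have "\<dots> = (\<Sum>w\<in>A. if base0 w = a then u w else 0)"
        using mX[OF i] orig[OF i] X by (intro sum.cong) auto
      finally have *: "(\<Sum>x\<in>X. if base x = a then \<Sum>w\<in>A. if m i w = x then u w else 0 else 0)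
          = (\<Sum>w\<in>A. if base0 w = a then u w else 0)" .
      have "pmf (map_pmf base (r i)) a = (\<Sum>x\<in>X. if base x = a then res i x else 0) / c"
        unfolding pmf_map_eq_sum[OF X rX[OF i]] sum_divide_distrib
        by (intro sum.cong) (auto simp: r[OF i])
      also have "(\<Sum>x\<in>X. if base x = a then res i x else 0) =
         (\<Sum>x\<in>X. (if base x = a then pmf \<nu>' x else 0) - (if base x = a then \<Sum>w\<in>A. if m i w = x then u w else 0 else 0))"
        by (intro sum.cong) (auto simp: res_def)
      finally show ?thesis
        by (simp add: sum_subtractf * pmf_map_eq_sum[OF X nu'])
    qed
    have "\<exists>\<rho>. set_pmf \<rho> \<subseteq> A \<and> (\<forall>i\<in>I. map_pmf (m i) \<rho> = r i)"
    proof (rule glue)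
      fix i assume i: "i \<in> I"
      have "map_pmf base (r i) = map_pmf base (r (SOME j. j \<in> I))"
        using r_orig[OF i] r_orig[OF someI[of "\<lambda>j. j \<in> I", OF i]] by (intro pmf_eqI) simp
      then show "set_pmf (r i) \<subseteq> X \<and> map_pmf base (r i) = map_pmf base (r (SOME j. j \<in> I))"
        using rX[OF i] by simp
    qed
    then show ?thesis using r False by (metis nonzero_mult_div_cancel_left times_divide_eq_right)
  qed
  then obtain \<rho> where \<rho>: "set_pmf \<rho> \<subseteq> A" "\<And>i x. i \<in> I \<Longrightarrow> c * pmf (map_pmf (m i) \<rho>) x = res i x"
    by blast
  have "\<exists>\<mu>'. \<forall>w. pmf \<mu>' w = u w + c * pmf \<rho> w"
  proof (rule exists_pmf_on_finite[OF A(1)])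
    show "u w + c * pmf \<rho> w = 0" if "w \<notin> A" for w
    proof -
      have "pmf \<mu> w = 0" "pmf \<rho> w = 0"
        using that A(2) \<rho>(1) by (auto simp: pmf_eq_0_set_pmf)
      then show ?thesis by (simp add: u_def)
    qed
    show "(\<Sum>w\<in>A. u w + c * pmf \<rho> w) = 1"
      by (simp add: sum.distrib sum_distrib_left[symmetric] sum_pmf_eq_1[OF A(1) \<rho>(1)] c_def)
  qed (use u0 c0 in auto)
  then obtain \<mu>' where \<mu>': "\<And>w. pmf \<mu>' w = u w + c * pmf \<rho> w" by blast
  have A': "set_pmf \<mu>' \<subseteq> A"
  proof
    fix w assume "w \<in> set_pmf \<mu>'"
    then have "pmf \<mu> w \<noteq> 0 \<or> pmf \<rho> w \<noteq> 0" by (auto simp: set_pmf_iff \<mu>' u_def)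
    then show "w \<in> A" using A(2) \<rho>(1) by (auto simp: set_pmf_iff[symmetric])
  qed
  have "map_pmf (m i) \<mu>' = \<nu>'" if i: "i \<in> I" for i
  proof (rule pmf_eqI)
    fix x
    have "pmf (map_pmf (m i) \<mu>') x =
        (\<Sum>w\<in>A. (if m i w = x then u w else 0) + c * (if m i w = x then pmf \<rho> w else 0))"
      unfolding pmf_map_eq_sum[OF A(1) A'] by (intro sum.cong) (auto simp: \<mu>')
    also have "\<dots> = (\<Sum>w\<in>A. if m i w = x then u w else 0) + res i x"
      by (simp add: sum.distrib sum_distrib_left[symmetric] \<rho>(2)[OF i, symmetric]
        pmf_map_eq_sum[OF A(1) \<rho>(1)])
    finally show "pmf (map_pmf (m i) \<mu>') x = pmf \<nu>' x" by (simp add: res_def)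
  qed
  moreover have "tv_dist \<mu> \<mu>' \<le> c"
  proof (rule tv_dist_leI)
    fix W
    let ?P = "\<lambda>h. \<Sum>w\<in>A. if w \<in> W then h w else (0::real)"
    have mu': "?P (pmf \<mu>') = ?P u + c * ?P (pmf \<rho>)"
      unfolding sum_distrib_left sum.distrib[symmetric] by (intro sum.cong) (auto simp: \<mu>')
    have "?P (pmf \<rho>) \<le> 1" "0 \<le> ?P (pmf \<rho>)"
      using measure_pmf.prob_le_1[of \<rho> W] measure_nonneg[of \<rho> W]
      by (simp_all add: prob_eq_sum[OF A(1) \<rho>(1)])
    then have 1: "0 \<le> c * ?P (pmf \<rho>)" "c * ?P (pmf \<rho>) \<le> c"
      using c0 by (auto intro: mult_left_le)
    have 2: "?P u \<le> ?P (pmf \<mu>)"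
      using u_le by (intro sum_mono) auto
    have "?P (pmf \<mu>) - ?P u = (\<Sum>w\<in>A. if w \<in> W then pmf \<mu> w - u w else 0)"
      unfolding sum_subtractf[symmetric] by (intro sum.cong) auto
    also have "\<dots> \<le> (\<Sum>w\<in>A. pmf \<mu> w - u w)"
      using u_le by (intro sum_mono) auto
    also have "\<dots> = c" by (simp add: sum_subtractf mu1 c_def)
    finally show "\<bar>measure_pmf.prob \<mu> W - measure_pmf.prob \<mu>' W\<bar> \<le> c"
      unfolding prob_eq_sum[OF A] prob_eq_sum[OF A(1) A'] mu' using 1 2 by linarith
  qed
  ultimately show ?thesis using A' c_le by (intro exI[of _ \<mu>']) auto
qed

section \<open>Marginals and entropy of product measures\<close>

lemma mem_cube: "v \<in> cube d n \<longleftrightarrow> (\<forall>i<d. 0 \<le> v i \<and> v i < int n) \<and> (\<forall>i\<ge>d. v i = 0)"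
  unfolding cube_def PiE_dflt_def mem_Collect_eq lessThan_iff atLeastLessThan_iff
  by (meson not_le)

lemma cube_nonempty: "n \<ge> 1 \<Longrightarrow> cube d n \<noteq> {}"
  using card_cube[of d n] by (metis card.empty not_one_le_zero power_not_zero)

lemma marginal_along_cong:
  "(\<And>t. t \<in> T \<Longrightarrow> f t = g t) \<Longrightarrow> marginal_along f T \<mu> = marginal_along g T \<mu>"
  unfolding marginal_along_def by (intro arg_cong2[where f = map_pmf]) (auto simp: restrict_def fun_eq_iff)

lemma marginal_along_marginal_along:
  "g ` T \<subseteq> S \<Longrightarrow> marginal_along g T (marginal_along f S \<mu>) = marginal_along (f \<circ> g) T \<mu>"
  unfolding marginal_along_def map_pmf_comp
  by (intro arg_cong2[where f = map_pmf]) (auto simp: restrict_def fun_eq_iff)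

lemma marginal_along_bind:
  "marginal_along f T (bind_pmf M K) = bind_pmf M (\<lambda>x. marginal_along f T (K x))"
  unfolding marginal_along_def by (simp add: map_bind_pmf)

lemma marginal_along_in_measures_on: "marginal_along f T \<mu> \<in> measures_on T"
  unfolding marginal_along_def measures_on_def by auto

lemma mean_marginal_in_measures_on: "mean_marginal d n S \<mu> \<in> measures_on S"
  using marginal_along_in_measures_on[of _ S \<mu>]
  unfolding mean_marginal_def measures_on_def by auto

text \<open>
  Injectivity matters here: where \<open>f\<close> is not injective, the marginal repeats a letter instead of
  drawing it twice independently.
\<close>

lemma marginal_along_Pi_pmf:
  assumes A: "finite A" and f: "inj_on f T" "f ` T \<subseteq> A"
  shows "marginal_along f T (Pi_pmf A undefined p) = Pi_pmf T undefined (p \<circ> f)"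
proof (rule pmf_eqI)
  fix w
  have T: "finite T" using A f by (meson finite_imageD finite_subset)
  let ?B = "f ` T"
  have B: "finite ?B" using T by simp
  have sub: "Pi_pmf ?B undefined p = map_pmf (\<lambda>g. restrict g ?B) (Pi_pmf A undefined p)"
    using Pi_pmf_subset[OF A f(2), of undefined p] by (simp add: restrict_def[abs_def])
  have "marginal_along f T (Pi_pmf A undefined p) = marginal_along f T (Pi_pmf ?B undefined p)"
    unfolding sub marginal_along_def map_pmf_comp
    by (intro arg_cong2[where f = map_pmf]) (auto simp: restrict_def fun_eq_iff)
  also have "pmf \<dots> w = pmf (Pi_pmf T undefined (p \<circ> f)) w"
  proof (cases "\<forall>x. x \<notin> T \<longrightarrow> w x = undefined")
    case False
    then have "w \<notin> extensional T" by (auto simp: extensional_def)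
    then have "pmf (marginal_along f T (Pi_pmf ?B undefined p)) w = 0"
      unfolding marginal_along_def by (intro pmf_map_outside) auto
    then show ?thesis using False T by (auto simp: pmf_Pi)
  next
    case True
    define g where "g = restrict (w \<circ> the_inv_into T f) ?B"
    have gw: "restrict (g \<circ> f) T = w"
      using True f(1) by (auto simp: g_def fun_eq_iff restrict_def the_inv_into_f_f)
    have ext: "h \<in> extensional ?B" if "h \<in> set_pmf (Pi_pmf ?B undefined p)" for h
      using that set_Pi_pmf_subset[OF B, of undefined p] by (auto simp: extensional_def)
    have "h = g" if h: "h \<in> extensional ?B" "restrict (h \<circ> f) T = w" for h
    proof (rule extensionalityI[OF h(1)])
      show "h x = g x" if "x \<in> ?B" for x
        using that h(2) gw by (metis comp_apply imageE restrict_apply')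
    qed (simp add: g_def)
    then have "pmf (marginal_along f T (Pi_pmf ?B undefined p)) w
        = measure_pmf.prob (Pi_pmf ?B undefined p) {g}"
      unfolding marginal_along_def pmf_map using ext gw
      by (intro measure_pmf.finite_measure_eq_AE) (auto simp: AE_measure_pmf_iff)
    also have "\<dots> = (\<Prod>x\<in>?B. pmf (p x) (g x))"
      using B by (simp add: measure_pmf_single) (subst pmf_Pi', auto simp: g_def)
    also have "\<dots> = (\<Prod>t\<in>T. pmf (p (f t)) (w t))"
      using f(1) gw by (subst prod.reindex) (auto simp: g_def the_inv_into_f_f)
    finally show ?thesis using True T by (simp add: pmf_Pi')
  qed
  finally show "pmf (marginal_along f T (Pi_pmf A undefined p)) w = pmf (Pi_pmf T undefined (p \<circ> f)) w" .
qed

lemma shannon_map_inj: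
  assumes "inj_on f (set_pmf \<mu>)"
  shows "shannon (map_pmf f \<mu>) = shannon \<mu>"
  unfolding shannon_def set_map_pmf
  by (subst sum.reindex[OF assms]) (auto simp: pmf_map_inj[OF assms] intro!: sum.cong)

lemma shannon_pair:
  assumes "finite (set_pmf \<mu>)" "finite (set_pmf \<nu>)"
  shows "shannon (pair_pmf \<mu> \<nu>) = shannon \<mu> + shannon \<nu>"
proof -
  let ?A = "set_pmf \<mu>" and ?B = "set_pmf \<nu>"
  have "(\<Sum>w\<in>set_pmf (pair_pmf \<mu> \<nu>). pmf (pair_pmf \<mu> \<nu>) w * log 2 (pmf (pair_pmf \<mu> \<nu>) w))
      = (\<Sum>x\<in>?A. \<Sum>y\<in>?B. pmf \<mu> x * log 2 (pmf \<mu> x) * pmf \<nu> y + pmf \<mu> x * (pmf \<nu> y * log 2 (pmf \<nu> y)))"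
    unfolding set_pair_pmf sum.cartesian_product
    by (intro sum.cong) (auto simp: pmf_pair log_mult pmf_positive algebra_simps)
  also have "\<dots> = (\<Sum>x\<in>?A. pmf \<mu> x * log 2 (pmf \<mu> x)) + (\<Sum>y\<in>?B. pmf \<nu> y * log 2 (pmf \<nu> y))"
    using sum_pmf_eq_1[OF assms(1) order_refl] sum_pmf_eq_1[OF assms(2) order_refl]
    by (simp add: sum.distrib sum_distrib_left[symmetric] sum_distrib_right[symmetric])
  finally show ?thesis by (simp add: shannon_def)
qed

lemma shannon_Pi_pmf:
  fixes p :: "'s \<Rightarrow> 'a::finite pmf"
  assumes "finite A"
  shows "shannon (Pi_pmf A undefined p) = (\<Sum>x\<in>A. shannon (p x))"
  using assms
proof (induction A)
  case empty
  then show ?case by (simp add: shannon_def)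
next
  case (insert a A)
  let ?P = "Pi_pmf A undefined p"
  have fin: "finite (set_pmf ?P)"
    using insert.hyps by (simp add: set_Pi_pmf finite_PiE_dflt)
  have "inj_on (\<lambda>(y, f). f(a := y)) (set_pmf (pair_pmf (p a) ?P))"
  proof (rule inj_onI, clarify)
    fix y f z g
    assume m: "(y, f) \<in> set_pmf (pair_pmf (p a) ?P)" "(z, g) \<in> set_pmf (pair_pmf (p a) ?P)"
      and eq: "f(a := y) = g(a := z)"
    then have "f a = undefined" "g a = undefined"
      using set_Pi_pmf_subset[OF insert.hyps(1), of undefined p] insert.hyps(2) by auto
    then show "y = z \<and> f = g" using eq by (metis fun_upd_same fun_upd_triv fun_upd_upd)
  qed
  then have "shannon (Pi_pmf (insert a A) undefined p) = shannon (p a) + shannon ?P"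
    using insert.hyps fin by (simp add: Pi_pmf_insert shannon_map_inj shannon_pair)
  then show ?case using insert by simp
qed

text \<open>
  Written as an expectation over a uniform site, the entropy per site changes with \<open>p\<close> and the
  torus only through the distribution of \<open>p v\<close>.
\<close>

lemma entropy_rate_Pi_pmf:
  fixes p :: "point \<Rightarrow> 'a::finite pmf"
  assumes "n \<ge> 1"
  shows "1 / real n ^ d * shannon (Pi_pmf (cube d n) undefined p)
    = measure_pmf.expectation (pmf_of_set (cube d n)) (\<lambda>v. shannon (p v))"
  by (simp only: shannon_Pi_pmf[OF finite_cube] integral_pmf_of_set[OF cube_nonempty[OF assms] finite_cube]
      card_cube of_nat_power) (simp add: field_simps)

section \<open>Maps between tori that preserve the uniform distribution\<close>

lemma inj_axis_point: "inj (axis_point i)"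
proof (rule injI)
  fix x y assume "axis_point i x = axis_point i y"
  from fun_cong[OF this, of i] show "x = y" by (simp add: axis_point_def)
qed

lemma zero_in_cube: "k \<ge> 1 \<Longrightarrow> (\<lambda>_. 0) \<in> cube d k"
  by (auto simp: mem_cube)

lemma cube_1_eqI: "s \<in> cube 1 k \<Longrightarrow> t \<in> cube 1 k \<Longrightarrow> s 0 = t 0 \<Longrightarrow> s = t"
proof
  fix l assume "s \<in> cube 1 k" "t \<in> cube 1 k" "s 0 = t 0"
  then show "s l = t l" by (cases "l = 0") (auto simp: mem_cube)
qed

lemma pmf_of_set_cube_1:
  assumes "n \<ge> 1"
  shows "pmf_of_set (cube 1 n) = map_pmf (axis_point 0) (pmf_of_set {0..<int n})"
  using assms inj_axis_point[of 0]
  by (subst map_pmf_of_set_inj) (auto simp: axis_point_cube_1[of n, simplified] inj_def inj_on_def)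

lemma map_coordinate_pmf_of_set_cube:
  assumes "n \<ge> 1" "i < d"
  shows "map_pmf (\<lambda>v. v i) (pmf_of_set (cube d n)) = pmf_of_set {0..<int n}"
proof -
  have "pmf_of_set (cube d n) = Pi_pmf {..<d} 0 (\<lambda>_. pmf_of_set {0..<int n})"
    unfolding cube_def using assms by (intro Pi_pmf_of_set[symmetric]) auto
  then show ?thesis using assms by (simp add: Pi_pmf_component)
qed

text \<open>
  Replacing coordinate \<open>0\<close> by the coordinate sum modulo \<open>n\<close> is a bijection of the torus, since
  coordinate \<open>0\<close> can be recovered from the sum and the remaining coordinates.  The sum is thus
  distributed as a single coordinate.
\<close>

lemma map_coordinate_sum_pmf_of_set_cube:
  assumes n: "n \<ge> 1" and d: "d \<ge> 1"
  shows "map_pmf (\<lambda>v. axis_point 0 ((\<Sum>l<d. v l) mod int n)) (pmf_of_set (cube d n))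
    = pmf_of_set (cube 1 n)"
proof -
  let ?s = "\<lambda>v::point. (\<Sum>l<d. v l) mod int n"
  define shear where "shear v = v(0 := ?s v)" for v :: point
  have into: "shear ` cube d n \<subseteq> cube d n"
    using n d by (auto simp: shear_def mem_cube)
  have "inj_on shear (cube d n)"
  proof (rule inj_onI)
    fix v w assume v: "v \<in> cube d n" and w: "w \<in> cube d n" and eq: "shear v = shear w"
    have other: "v l = w l" if "l \<noteq> 0" for l
      using fun_cong[OF eq, of l] that by (simp add: shear_def)
    have split: "(\<Sum>l<d. u l) = u 0 + (\<Sum>l\<in>{..<d} - {0}. u l)" for u :: point
      using d by (intro sum.remove) auto
    have "(\<Sum>l\<in>{..<d} - {0}. v l) = (\<Sum>l\<in>{..<d} - {0}. w l)"
      using other by (intro sum.cong) auto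
    moreover have "?s v = ?s w"
      using fun_cong[OF eq, of 0] by (simp add: shear_def)
    ultimately have "v 0 mod int n = w 0 mod int n"
      unfolding split by (metis add_diff_cancel_right' mod_diff_left_eq)
    then have "v 0 = w 0"
      using v w d by (auto simp: mem_cube)
    then show "v = w" using other by (intro ext) metis
  qed
  then have "bij_betw shear (cube d n) (cube d n)"
    using into finite_cube by (metis bij_betw_def endo_inj_surj)
  then have "map_pmf shear (pmf_of_set (cube d n)) = pmf_of_set (cube d n)"
    using cube_nonempty[OF n] finite_cube by (intro map_pmf_of_set_bij_betw)
  then have "map_pmf (\<lambda>v. v 0) (map_pmf shear (pmf_of_set (cube d n))) = pmf_of_set {0..<int n}"
    using map_coordinate_pmf_of_set_cube[OF n, of 0 d] d by simp
  then have "map_pmf ?s (pmf_of_set (cube d n)) = pmf_of_set {0..<int n}"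
    by (simp add: map_pmf_comp shear_def)
  then have "map_pmf (axis_point 0) (map_pmf ?s (pmf_of_set (cube d n))) = pmf_of_set (cube 1 n)"
    using pmf_of_set_cube_1[OF n] by simp
  then show ?thesis by (simp add: map_pmf_comp)
qed

text \<open>
  The base-\<open>n\<close> digits of a position on the cycle of length \<open>n ^ d\<close>, as a point of the
  \<open>d\<close>-dimensional torus.  Positions that agree in all but the lowest digit form a line in
  direction \<open>0\<close>, so the cycle runs through these lines one after the other.
\<close>

definition digits :: "nat \<Rightarrow> nat \<Rightarrow> point \<Rightarrow> point" where
  "digits d n t = (\<lambda>i. if i < d then t 0 div int n ^ i mod int n else 0)"

lemma digits_inject:
  assumes "n \<ge> 1" "0 \<le> (s::int)" "s < int n ^ d" "0 \<le> t" "t < int n ^ d"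
    "\<And>i. i < d \<Longrightarrow> s div int n ^ i mod int n = t div int n ^ i mod int n"
  shows "s = t"
  using assms
proof (induction d arbitrary: s t)
  case (Suc d)
  have bnd: "0 \<le> u div int n \<and> u div int n < int n ^ d" if "0 \<le> u" "u < int n ^ Suc d" for u
  proof -
    have "int n * (u div int n) \<le> u"
      using mult_div_mod_eq[of "int n" u] pos_mod_sign[of "int n" u] Suc.prems(1) by linarith
    then have "int n * (u div int n) < int n * int n ^ d"
      using that(2) by simp
    then show ?thesis
      using that(1) Suc.prems(1) by (simp add: pos_imp_zdiv_nonneg_iff)
  qed
  have "s div int n = t div int n"
  proof (rule Suc.IH)
    fix i assume "i < d"
    then show "s div int n div int n ^ i mod int n = t div int n div int n ^ i mod int n"
      using Suc.prems(6)[of "Suc i"] by (simp add: zdiv_zmult2_eq)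
  qed (use Suc.prems bnd in auto)
  moreover have "s mod int n = t mod int n"
    using Suc.prems(6)[of 0] by simp
  ultimately show ?case by (metis mult_div_mod_eq)
qed auto

lemma bij_betw_digits:
  assumes n: "n \<ge> 1"
  shows "bij_betw (digits d n) (cube 1 (n ^ d)) (cube d n)"
proof -
  have "inj_on (digits d n) (cube 1 (n ^ d))"
  proof (rule inj_onI)
    fix s t assume s: "s \<in> cube 1 (n ^ d)" and t: "t \<in> cube 1 (n ^ d)"
      and eq: "digits d n s = digits d n t"
    have "s 0 = t 0"
    proof (rule digits_inject[OF n])
      fix i assume "i < d"
      then show "s 0 div int n ^ i mod int n = t 0 div int n ^ i mod int n"
        using fun_cong[OF eq, of i] by (simp add: digits_def)
    qed (use s t in \<open>auto simp: mem_cube\<close>)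
    then show "s = t" using s t by (rule cube_1_eqI[rotated 2])
  qed
  moreover have "digits d n ` cube 1 (n ^ d) \<subseteq> cube d n"
    using n by (auto simp: mem_cube digits_def)
  ultimately show ?thesis
    unfolding bij_betw_def by (simp add: card_image card_cube finite_cube card_subset_eq)
qed

text \<open>
  A step of length \<open>j\<close> that causes no carry stays on the same line.  It does not wrap around the
  long cycle either, as a wrap would carry through all digits.
\<close>

lemma digits_shift:
  assumes n: "n \<ge> 1" and d: "d \<ge> 1" and t: "t \<in> cube 1 (n ^ d)" and j: "0 \<le> j"
    and fit: "t 0 mod int n + j < int n"
  shows "digits d n (shift_mod (n ^ d) t (axis_point 0 j)) = shift_mod n (digits d n t) (axis_point 0 j)"
proof -
  let ?n = "int n" and ?t = "t 0"
  have n0: "0 < ?n" using n by simp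
  have md: "0 \<le> ?t mod ?n" using n0 by simp
  have dv: "(j + ?t) div ?n = ?t div ?n"
  proof -
    have "j + ?t = (j + ?t mod ?n) + ?n * (?t div ?n)" by simp
    also have "\<dots> div ?n = ?t div ?n"
      using fit j md n0 by (subst div_mult_self2) (auto simp: div_pos_pos_trivial)
    finally show ?thesis .
  qed
  have dvi: "(j + ?t) div ?n ^ i = ?t div ?n ^ i" if "i \<ge> 1" for i
  proof -
    obtain l where "i = Suc l" using \<open>i \<ge> 1\<close> by (cases i) auto
    then show ?thesis using dv n0 by (simp add: zdiv_zmult2_eq)
  qed
  have t0: "0 \<le> ?t" "?t < ?n ^ d"
    using t by (auto simp: mem_cube)
  have "?t div ?n ^ d = 0" using t0 by simp
  then have "(j + ?t) div ?n ^ d = 0" using dvi[OF d] by simp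
  then have "(j + ?t) < ?n ^ d"
    using t0 j unfolding zdiv_eq_0_iff by linarith
  then have N: "(j + ?t) mod int (n ^ d) = j + ?t" using t0 j by simp
  have s0: "shift_mod (n ^ d) t (axis_point 0 j) 0 = j + ?t"
    using N by (simp add: shift_mod_def axis_point_def)
  have "(if i < d then (j + ?t) div ?n ^ i mod ?n else 0)
      = ((if i = 0 then j else 0) + (if i < d then ?t div ?n ^ i mod ?n else 0)) mod ?n" for i
    using d dvi[of i] by (cases "i = 0") (auto simp: mod_add_right_eq)
  then show ?thesis
    unfolding digits_def s0 by (simp only: shift_mod_def axis_point_def)
qed

section \<open>Measures on the cross-shaped window\<close>

abbreviation axis_marginal ::
    "nat \<Rightarrow> nat \<Rightarrow> (point \<Rightarrow> 'a) pmf \<Rightarrow> (point \<Rightarrow> 'a) pmf" where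
  "axis_marginal i k \<equiv> marginal_along (\<lambda>s. axis_point i (s 0)) (cube 1 k)"

lemma axis_point_zero: "axis_point i 0 = (\<lambda>_. 0)"
  by (auto simp: axis_point_def)

lemma axis_point_cube_1_id: "s \<in> cube 1 k \<Longrightarrow> axis_point 0 (s 0) = s"
  by (rule cube_1_eqI[of _ k]) (auto simp: mem_cube axis_point_def)

lemma axis_point_in_axial_window:
  "s \<in> cube 1 k \<Longrightarrow> i < d \<Longrightarrow> axis_point i (s 0) \<in> axial_window d k"
  unfolding axial_window_def by (intro UN_I[of i] imageI) (auto simp: mem_cube)

lemma finite_axial_window: "finite (axial_window d k)"
  by (auto simp: axial_window_def)

text \<open>
  The axes meet only at the origin.  Drawing the letter there first, and then the configurations on
  the axes independently from their conditional distributions, gives the letters at the origin the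
  same value on every axis, so the configurations fit together.
\<close>

lemma exists_pmf_with_axis_marginals:
  fixes r :: "nat \<Rightarrow> (point \<Rightarrow> 'a::finite) pmf"
  assumes k: "k \<ge> 1"
    and r: "\<And>i. i < d \<Longrightarrow> r i \<in> measures_on (cube 1 k)"
    and q: "\<And>i. i < d \<Longrightarrow> map_pmf (\<lambda>x. x (\<lambda>_. 0)) (r i) = q"
  shows "\<exists>\<rho>\<in>measures_on (axial_window d k). \<forall>i<d. axis_marginal i k \<rho> = r i"
proof -
  let ?W = "axial_window d k" and ?z = "(\<lambda>_. 0) :: point"
  \<comment> \<open>at the origin an arbitrary axis is chosen; the configurations to be combined agree there\<close>
  define axis where "axis s = (SOME i. i < d \<and> s \<in> axis_point i ` {0..<int k})" for s
  have axis: "axis s < d \<and> s \<in> axis_point (axis s) ` {0..<int k}" if "s \<in> ?W" for s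
    unfolding axis_def by (rule someI_ex) (use that in \<open>auto simp: axial_window_def\<close>)
  define combine :: "(nat \<Rightarrow> point \<Rightarrow> 'a) \<Rightarrow> point \<Rightarrow> 'a" where
    "combine xs = restrict (\<lambda>s. xs (axis s) (axis_point 0 (s (axis s)))) ?W" for xs
  define K where "K a = Pi_pmf {..<d} undefined (\<lambda>i. cond_pmf (r i) {x. x ?z = a})" for a
  define \<rho> where "\<rho> = bind_pmf q (\<lambda>a. map_pmf combine (K a))"
  have K_marg: "map_pmf (\<lambda>xs. restrict (combine xs \<circ> (\<lambda>s. axis_point i (s 0))) (cube 1 k)) (K a)
      = cond_pmf (r i) {x. x ?z = a}" if i: "i < d" and a: "a \<in> set_pmf q" for i a
  proof -
    have ne: "set_pmf (r l) \<inter> {x. x ?z = a} \<noteq> {}" if "l < d" for l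
      using a unfolding q[OF that, symmetric] by auto
    have "restrict (combine xs \<circ> (\<lambda>s. axis_point i (s 0))) (cube 1 k) = xs i"
      if xs: "xs \<in> set_pmf (K a)" for xs
    proof -
      have mem: "xs l \<in> set_pmf (r l) \<and> xs l ?z = a" if "l < d" for l
        using xs that set_cond_pmf[OF ne[OF that]]
        by (auto simp: K_def set_Pi_pmf PiE_dflt_def)
      have "xs i \<in> extensional (cube 1 k)"
        using mem[OF i] r[OF i] by (auto simp: measures_on_def PiE_def)
      then show ?thesis
      proof (rule extensionalityI[rotated])
        fix s assume s: "s \<in> cube 1 k"
        let ?t = "axis_point i (s 0)"
        have t: "?t \<in> ?W" by (rule axis_point_in_axial_window[OF s i])
        have "xs (axis ?t) (axis_point 0 (?t (axis ?t))) = xs i s"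
        proof (cases "axis ?t = i")
          case True
          then show ?thesis using axis_point_cube_1_id[OF s] by (simp add: axis_point_def)
        next
          case False
          \<comment> \<open>a point on two distinct axes is the origin, where all \<open>xs l\<close> take the value \<open>a\<close>\<close>
          obtain c where "?t = axis_point (axis ?t) c" using axis[OF t] by auto
          from fun_cong[OF this, of i] have "s 0 = 0"
            using False by (simp add: axis_point_def)
          then have "s = ?z" using axis_point_cube_1_id[OF s] axis_point_zero by metis
          then show ?thesis
            using mem[of "axis ?t"] mem[OF i] axis[OF t] by (simp add: axis_point_zero)
        qed
        then show "restrict (combine xs \<circ> (\<lambda>s. axis_point i (s 0))) (cube 1 k) s = xs i s"
          using s t by (simp add: combine_def)
      qed auto
    qed
    then have "map_pmf (\<lambda>xs. restrict (combine xs \<circ> (\<lambda>s. axis_point i (s 0))) (cube 1 k)) (K a)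
        = map_pmf (\<lambda>xs. xs i) (K a)"
      by (intro map_pmf_cong) auto
    then show ?thesis using i by (simp add: K_def Pi_pmf_component)
  qed
  have "axis_marginal i k \<rho> = r i" if i: "i < d" for i
  proof -
    have "axis_marginal i k \<rho> = bind_pmf q (\<lambda>a. cond_pmf (r i) {x. x ?z = a})"
      unfolding \<rho>_def marginal_along_bind using K_marg[OF i]
      by (intro bind_pmf_cong) (auto simp: marginal_along_def map_pmf_comp)
    also have "\<dots> = r i"
    proof (rule bind_cond_pmf_cancel)
      show "measure_pmf.prob (r i) {y. y ?z = a} = measure_pmf.prob q {x. y ?z = x}"
        if "y ?z = a" for a and y :: "point \<Rightarrow> 'a"
        using that unfolding q[OF i, symmetric] by (simp add: vimage_def eq_commute)
    qed (auto simp: q[OF i, symmetric])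
    finally show ?thesis .
  qed
  moreover have "\<rho> \<in> measures_on ?W"
    by (auto simp: \<rho>_def measures_on_def combine_def)
  ultimately show ?thesis by blast
qed

text \<open>
  The correction of marginals above, with the letter at the origin as the common part.  It shows
  that a measure whose axis marginals coincide and are close to \<open>\<Gamma>\<close> is itself close to the axial
  product of \<open>\<Gamma>\<close>.
\<close>

lemma exists_near_pmf_with_axis_marginals:
  fixes \<mu> :: "(point \<Rightarrow> 'a::finite) pmf"
  assumes k: "k \<ge> 1" and d: "d \<ge> 1"
    and \<mu>: "\<mu> \<in> measures_on (axial_window d k)"
    and marg: "\<And>i. i < d \<Longrightarrow> axis_marginal i k \<mu> = \<nu>"
    and \<nu>': "\<nu>' \<in> measures_on (cube 1 k)"
  shows "\<exists>\<mu>'\<in>measures_on (axial_window d k).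
    (\<forall>i<d. axis_marginal i k \<mu>' = \<nu>') \<and> tv_dist \<mu> \<mu>' \<le> real d * tv_dist \<nu> \<nu>'"
proof -
  let ?z = "(\<lambda>_. 0) :: point"
  let ?A = "axial_window d k \<rightarrow>\<^sub>E (UNIV :: 'a set)" and ?X = "cube 1 k \<rightarrow>\<^sub>E (UNIV :: 'a set)"
  let ?m = "\<lambda>i w. restrict (w \<circ> (\<lambda>s. axis_point i (s 0))) (cube 1 k)"
  have \<nu>: "\<nu> \<in> measures_on (cube 1 k)"
    using marg[of 0] marginal_along_in_measures_on d by force
  have "\<exists>\<mu>'. set_pmf \<mu>' \<subseteq> ?A \<and> (\<forall>i\<in>{..<d}. map_pmf (?m i) \<mu>' = \<nu>') \<and>
      tv_dist \<mu> \<mu>' \<le> real (card {..<d}) * tv_dist \<nu> \<nu>'"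
  proof (rule exists_pmf_with_marginals_near[where base = "\<lambda>x. x ?z" and ?base0.0 = "\<lambda>w. w ?z" and X = ?X])
    show "\<exists>\<rho>. set_pmf \<rho> \<subseteq> ?A \<and> (\<forall>i\<in>{..<d}. map_pmf (?m i) \<rho> = r i)"
      if "\<And>i. i \<in> {..<d} \<Longrightarrow> set_pmf (r i) \<subseteq> ?X \<and> map_pmf (\<lambda>x. x ?z) (r i) = q" for r q
    proof -
      from that have "\<exists>\<rho>\<in>measures_on (axial_window d k). \<forall>i<d. axis_marginal i k \<rho> = r i"
        by (intro exists_pmf_with_axis_marginals[OF k]) (auto simp: measures_on_def)
      then obtain \<rho> where "\<rho> \<in> measures_on (axial_window d k)" "\<forall>i<d. axis_marginal i k \<rho> = r i"
        by blast
      then show ?thesis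
        by (intro exI[of _ \<rho>]) (auto simp: measures_on_def marginal_along_def)
    qed
    show "?m i w ?z = w ?z" if "i \<in> {..<d}" "w \<in> ?A" for i w
      using zero_in_cube[OF k, of 1] by (simp add: axis_point_zero)
  qed (use \<mu> \<nu> \<nu>' marg in \<open>auto simp: measures_on_def marginal_along_def finite_axial_window finite_cube
      intro!: finite_PiE\<close>)
  then show ?thesis by (auto simp: measures_on_def marginal_along_def)
qed

section \<open>Mean marginals of product measures\<close>

lemma tv_nbhdD:
  assumes "\<mu> \<in> tv_nbhd \<epsilon> S \<Gamma>" "\<epsilon> < \<delta>"
  shows "\<exists>\<nu>\<in>\<Gamma>. tv_dist \<mu> \<nu> < \<delta>"
proof -
  have "(INF \<nu>\<in>\<Gamma>. ereal (tv_dist \<mu> \<nu>)) < ereal \<delta>"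
    using assms by (auto simp: tv_nbhd_def intro: le_less_trans)
  then show ?thesis by (auto simp: INF_less_iff)
qed

lemma tv_nbhdI:
  assumes "\<mu> \<in> measures_on S" "\<nu> \<in> \<Gamma>" "tv_dist \<mu> \<nu> \<le> \<epsilon>"
  shows "\<mu> \<in> tv_nbhd \<epsilon> S \<Gamma>"
  using assms by (auto simp: tv_nbhd_def intro!: INF_lower2[of \<nu>])

text \<open>
  As \<open>k \<le> n\<close>, a segment of length \<open>k\<close> does not overlap itself on the torus, so a translated segment
  carries a product measure.
\<close>

lemma axis_marginal_mean_marginal_Pi_pmf:
  assumes k: "k \<le> n" and n: "n \<ge> 1" and i: "i < d"
    and S: "(\<lambda>s. axis_point i (s 0)) ` cube 1 k \<subseteq> S"
  shows "axis_marginal i k (mean_marginal d n S (Pi_pmf (cube d n) undefined p)) =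
    bind_pmf (pmf_of_set (cube d n))
      (\<lambda>v. Pi_pmf (cube 1 k) undefined (\<lambda>s. p (shift_mod n v (axis_point i (s 0)))))"
proof -
  have "marginal_along (shift_mod n v \<circ> (\<lambda>s. axis_point i (s 0))) (cube 1 k) (Pi_pmf (cube d n) undefined p) =
      Pi_pmf (cube 1 k) undefined (\<lambda>s. p (shift_mod n v (axis_point i (s 0))))"
    if "v \<in> set_pmf (pmf_of_set (cube d n))" for v
  proof -
    have v: "v \<in> cube d n"
      using that cube_nonempty[OF n] finite_cube by (simp add: set_pmf_of_set)
    let ?f = "shift_mod n v \<circ> (\<lambda>s::point. axis_point i (s 0))"
    have "inj_on ?f (cube 1 k)"
    proof (rule inj_onI)
      fix s t assume s: "s \<in> cube 1 k" and t: "t \<in> cube 1 k" and eq: "?f s = ?f t"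
      have "(s 0 + v i) mod int n = (t 0 + v i) mod int n"
        using fun_cong[OF eq, of i] by (simp add: shift_mod_def axis_point_def)
      then have "s 0 mod int n = t 0 mod int n"
        by (metis add_diff_cancel_right' mod_diff_left_eq)
      moreover have "0 \<le> s 0" "s 0 < int n" "0 \<le> t 0" "t 0 < int n"
        using s t k by (auto simp: mem_cube)
      ultimately show "s = t" using cube_1_eqI[OF s t] by simp
    qed
    moreover have "?f ` cube 1 k \<subseteq> cube d n"
      using v n i by (auto simp: mem_cube shift_mod_def axis_point_def)
    ultimately show ?thesis
      by (simp add: marginal_along_Pi_pmf[OF finite_cube] o_def)
  qed
  then show ?thesis
    unfolding mean_marginal_def marginal_along_bind marginal_along_marginal_along[OF S]
    by (intro bind_pmf_cong) auto
qed

lemma mean_marginal_Pi_pmf_1: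
  assumes "k \<le> n" "n \<ge> 1"
  shows "mean_marginal 1 n (cube 1 k) (Pi_pmf (cube 1 n) undefined p) =
    bind_pmf (pmf_of_set (cube 1 n)) (\<lambda>v. Pi_pmf (cube 1 k) undefined (\<lambda>s. p (shift_mod n v s)))"
    (is "?M = _")
proof -
  have id: "axis_point 0 (s 0) = s" if "s \<in> cube 1 k" for s
    using that by (rule axis_point_cube_1_id)
  have "axis_marginal 0 k ?M = ?M"
    unfolding mean_marginal_def marginal_along_bind using id
    by (subst marginal_along_marginal_along) (auto intro!: bind_pmf_cong marginal_along_cong)
  moreover have "Pi_pmf (cube 1 k) undefined (\<lambda>s. p (shift_mod n v (axis_point 0 (s 0)))) =
      Pi_pmf (cube 1 k) undefined (\<lambda>s. p (shift_mod n v s))" for v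
    using id by (intro Pi_pmf_cong) auto
  moreover have "(\<lambda>s. axis_point 0 (s 0)) ` cube 1 k \<subseteq> cube 1 k"
    using id by auto
  ultimately show ?thesis
    using axis_marginal_mean_marginal_Pi_pmf[OF assms, of 0 1 "cube 1 k" p] by simp
qed

text \<open>
  Because of this, all axis marginals of a measure spread along diagonals agree with its mean
  marginal on the cycle.
\<close>

lemma coordinate_sum_shift:
  assumes "i < d" "s \<in> cube 1 k"
  shows "axis_point 0 ((\<Sum>l<d. shift_mod n v (axis_point i (s 0)) l) mod int n) =
    shift_mod n (axis_point 0 ((\<Sum>l<d. v l) mod int n)) s"
proof -
  have "(\<Sum>l<d. shift_mod n v (axis_point i (s 0)) l) mod int n
      = (\<Sum>l<d. axis_point i (s 0) l + v l) mod int n"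
    unfolding shift_mod_def by (rule mod_sum_eq)
  also have "(\<Sum>l<d. axis_point i (s 0) l + v l) = s 0 + (\<Sum>l<d. v l)"
    using assms(1) by (simp add: sum.distrib axis_point_def)
  finally show ?thesis
    using assms(2) by (auto simp: fun_eq_iff shift_mod_def axis_point_def mem_cube mod_add_right_eq)
qed

section \<open>Transfer between the cycle and the torus\<close>

text \<open>
  The transfer from the cycle to the torus is by the coordinate sum.  The radius is first doubled
  because the infimum in the definition of the neighbourhood need not be attained; the factor \<open>d\<close> is
  the price of correcting the marginals on \<open>d\<close> axes.
\<close>

lemma exists_axial_product_measure:
  fixes \<Gamma> :: "(point \<Rightarrow> 'a::finite) pmf set"
  assumes k: "k \<ge> 1" and d: "d \<ge> 1" and n: "k \<le> n" and \<epsilon>: "\<epsilon> > 0"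
    and \<Gamma>: "\<Gamma> \<subseteq> measures_on (cube 1 k)"
    and \<mu>: "\<mu> \<in> product_measures 1 n (cube 1 k) (tv_nbhd \<epsilon> (cube 1 k) \<Gamma>)"
  shows "\<exists>\<mu>'\<in>product_measures d n (axial_window d k)
        (tv_nbhd (2 * real d * \<epsilon>) (axial_window d k) (axial_product d k \<Gamma>)).
      1 / real n ^ d * shannon \<mu>' = 1 / real n ^ 1 * shannon \<mu>"
proof -
  have n1: "n \<ge> 1" using k n by simp
  obtain p where p: "\<mu> = Pi_pmf (cube 1 n) undefined p"
    using \<mu> by (auto simp: product_measures_def)
  let ?\<nu> = "mean_marginal 1 n (cube 1 k) \<mu>"
  obtain \<nu>' where \<nu>': "\<nu>' \<in> \<Gamma>" "tv_dist ?\<nu> \<nu>' < 2 * \<epsilon>"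
    using tv_nbhdD[of ?\<nu> \<epsilon> _ \<Gamma> "2 * \<epsilon>"] \<mu> \<epsilon> by (auto simp: product_measures_def)
  define \<sigma> where "\<sigma> v = axis_point 0 ((\<Sum>l<d. v l) mod int n)" for v :: point
  have law: "map_pmf \<sigma> (pmf_of_set (cube d n)) = pmf_of_set (cube 1 n)"
    unfolding \<sigma>_def by (rule map_coordinate_sum_pmf_of_set_cube[OF n1 d])
  define \<mu>' where "\<mu>' = Pi_pmf (cube d n) undefined (p \<circ> \<sigma>)"
  let ?M = "mean_marginal d n (axial_window d k) \<mu>'"
  have "axis_marginal i k ?M = ?\<nu>" if i: "i < d" for i
  proof -
    have "axis_marginal i k ?M = bind_pmf (pmf_of_set (cube d n))
        (\<lambda>v. Pi_pmf (cube 1 k) undefined (\<lambda>s. (p \<circ> \<sigma>) (shift_mod n v (axis_point i (s 0)))))"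
      unfolding \<mu>'_def using axis_point_in_axial_window i
      by (intro axis_marginal_mean_marginal_Pi_pmf n n1 i) auto
    also have "\<dots> = bind_pmf (pmf_of_set (cube d n))
        (\<lambda>v. Pi_pmf (cube 1 k) undefined (\<lambda>s. p (shift_mod n (\<sigma> v) s)))"
      unfolding \<sigma>_def by (intro bind_pmf_cong Pi_pmf_cong refl) (simp add: coordinate_sum_shift[OF i])
    also have "\<dots> = ?\<nu>"
      unfolding p mean_marginal_Pi_pmf_1[OF n n1] law[symmetric] by (simp add: bind_map_pmf)
    finally show ?thesis .
  qed
  then obtain \<rho> where \<rho>: "\<rho> \<in> measures_on (axial_window d k)" "\<And>i. i < d \<Longrightarrow> axis_marginal i k \<rho> = \<nu>'"
      "tv_dist ?M \<rho> \<le> real d * tv_dist ?\<nu> \<nu>'"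
    using exists_near_pmf_with_axis_marginals[OF k d, of ?M ?\<nu> \<nu>'] mean_marginal_in_measures_on \<nu>'(1) \<Gamma>
    by blast
  have "real d * tv_dist ?\<nu> \<nu>' \<le> real d * (2 * \<epsilon>)"
    using \<nu>'(2) by (intro mult_left_mono) auto
  then have "?M \<in> tv_nbhd (2 * real d * \<epsilon>) (axial_window d k) (axial_product d k \<Gamma>)"
    using \<rho> \<nu>'(1)
    by (intro tv_nbhdI[of _ _ \<rho>] mean_marginal_in_measures_on) (auto simp: axial_product_def)
  then have "\<mu>' \<in> product_measures d n (axial_window d k)
      (tv_nbhd (2 * real d * \<epsilon>) (axial_window d k) (axial_product d k \<Gamma>))"
    by (auto simp: product_measures_def \<mu>'_def)
  moreover have "1 / real n ^ d * shannon \<mu>' = 1 / real n ^ 1 * shannon \<mu>"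
    unfolding \<mu>'_def p entropy_rate_Pi_pmf[OF n1] law[symmetric] by simp
  ultimately show ?thesis by blast
qed

text \<open>
  The windows that run over the end of their line.
\<close>

lemma prob_last_positions_le:
  assumes n: "n \<ge> 1" and d: "d \<ge> 1"
  shows "measure_pmf.prob (pmf_of_set (cube d n)) {v. int n - int k < v 0} \<le> real k / real n"
proof -
  have "measure_pmf.prob (pmf_of_set (cube d n)) {v. int n - int k < v 0}
      = measure_pmf.prob (map_pmf (\<lambda>v. v 0) (pmf_of_set (cube d n))) {int n - int k<..}"
    by (simp add: vimage_def)
  also have "\<dots> = measure_pmf.prob (pmf_of_set {0..<int n}) {int n - int k<..}"
    using map_coordinate_pmf_of_set_cube[OF n, of 0 d] d by simp
  also have "\<dots> = real (card ({0..<int n} \<inter> {int n - int k<..})) / real n"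
    using n by (simp add: measure_pmf_of_set)
  also have "\<dots> \<le> real k / real n"
  proof (intro divide_right_mono of_nat_mono)
    have "card ({0..<int n} \<inter> {int n - int k<..}) \<le> card {int n - int k..<int n}"
      by (intro card_mono) auto
    then show "card ({0..<int n} \<inter> {int n - int k<..}) \<le> k" by simp
  qed simp
  finally show ?thesis .
qed

text \<open>
  The transfer from the torus to the cycle of length \<open>n ^ d\<close> is by base-\<open>n\<close> digits.  Of the radius
  \<open>3 * \<epsilon>\<close>, one \<open>\<epsilon>\<close> pays for the windows broken at line ends and the others for the neighbourhood,
  whose infimum need not be attained.
\<close>

lemma exists_line_product_measure:
  fixes \<Gamma> :: "(point \<Rightarrow> 'a::finite) pmf set"
  assumes k: "k \<ge> 1" and d: "d \<ge> 1" and n: "k \<le> n" and \<epsilon>: "\<epsilon> > 0"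
    and small: "real k / real n \<le> \<epsilon>"
    and \<mu>: "\<mu> \<in> product_measures d n (axial_window d k)
        (tv_nbhd \<epsilon> (axial_window d k) (axial_product d k \<Gamma>))"
  shows "\<exists>\<mu>'\<in>product_measures 1 (n ^ d) (cube 1 k) (tv_nbhd (3 * \<epsilon>) (cube 1 k) \<Gamma>).
      1 / real (n ^ d) ^ 1 * shannon \<mu>' = 1 / real n ^ d * shannon \<mu>"
proof -
  have n1: "n \<ge> 1" using k n by simp
  have N1: "n ^ d \<ge> 1" using n1 by simp
  have N: "k \<le> n ^ d" using n self_le_power[of n d] n1 d by simp
  obtain p where p: "\<mu> = Pi_pmf (cube d n) undefined p"
    using \<mu> by (auto simp: product_measures_def)
  let ?M = "mean_marginal d n (axial_window d k) \<mu>"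
  let ?\<delta> = "digits d n" and ?U = "pmf_of_set (cube 1 (n ^ d))"
  have law: "map_pmf ?\<delta> ?U = pmf_of_set (cube d n)"
    using bij_betw_digits[OF n1] cube_nonempty[OF N1] finite_cube by (intro map_pmf_of_set_bij_betw)
  obtain \<rho> where \<rho>: "\<rho> \<in> axial_product d k \<Gamma>" "tv_dist ?M \<rho> < 2 * \<epsilon>"
    using tv_nbhdD[of ?M \<epsilon> _ "axial_product d k \<Gamma>" "2 * \<epsilon>"] \<mu> \<epsilon> by (auto simp: product_measures_def)
  have near: "tv_dist (axis_marginal 0 k ?M) (axis_marginal 0 k \<rho>) \<le> tv_dist ?M \<rho>"
    unfolding marginal_along_def by (rule tv_dist_map_le)
  define \<mu>' where "\<mu>' = Pi_pmf (cube 1 (n ^ d)) undefined (p \<circ> ?\<delta>)"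
  let ?M' = "mean_marginal 1 (n ^ d) (cube 1 k) \<mu>'"
  \<comment> \<open>the starting positions of the windows that are broken at a line end\<close>
  let ?B = "{t. int n - int k < ?\<delta> t 0}"
  have M': "?M' = bind_pmf ?U (\<lambda>t. Pi_pmf (cube 1 k) undefined (\<lambda>s. p (?\<delta> (shift_mod (n ^ d) t s))))"
    unfolding \<mu>'_def mean_marginal_Pi_pmf_1[OF N N1] by simp
  have "axis_marginal 0 k ?M = bind_pmf (pmf_of_set (cube d n))
      (\<lambda>v. Pi_pmf (cube 1 k) undefined (\<lambda>s. p (shift_mod n v (axis_point 0 (s 0)))))"
    unfolding p using axis_point_in_axial_window d
    by (intro axis_marginal_mean_marginal_Pi_pmf n n1) auto
  then have M: "axis_marginal 0 k ?M =
      bind_pmf ?U (\<lambda>t. Pi_pmf (cube 1 k) undefined (\<lambda>s. p (shift_mod n (?\<delta> t) (axis_point 0 (s 0)))))"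
    by (simp add: law[symmetric] bind_map_pmf)
  have "tv_dist ?M' (axis_marginal 0 k ?M) \<le> measure_pmf.prob ?U ?B"
    unfolding M M'
  proof (intro tv_dist_bind_le Pi_pmf_cong refl)
    fix t s assume t: "t \<in> set_pmf ?U" "t \<notin> ?B" and s: "s \<in> cube 1 k"
    have "t \<in> cube 1 (n ^ d)"
      using t(1) cube_nonempty[OF N1] finite_cube by (simp add: set_pmf_of_set)
    moreover have "0 \<le> s 0" "t 0 mod int n + s 0 < int n"
      using t(2) s d by (auto simp: mem_cube digits_def)
    ultimately show "p (?\<delta> (shift_mod (n ^ d) t s)) = p (shift_mod n (?\<delta> t) (axis_point 0 (s 0)))"
      using digits_shift[OF n1 d] axis_point_cube_1_id[OF s] by metis
  qed
  also have "measure_pmf.prob ?U ?B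
      = measure_pmf.prob (map_pmf ?\<delta> ?U) {v. int n - int k < v 0}"
    by (simp add: vimage_def)
  also have "\<dots> \<le> \<epsilon>"
    unfolding law using prob_last_positions_le[OF n1 d, of k] small by linarith
  finally have "tv_dist ?M' (axis_marginal 0 k \<rho>) \<le> 3 * \<epsilon>"
    using near \<rho>(2) tv_dist_triangle[of ?M' "axis_marginal 0 k \<rho>" "axis_marginal 0 k ?M"] by linarith
  moreover have "axis_marginal 0 k \<rho> \<in> \<Gamma>"
    using \<rho>(1) d by (simp add: axial_product_def)
  ultimately have "?M' \<in> tv_nbhd (3 * \<epsilon>) (cube 1 k) \<Gamma>"
    by (intro tv_nbhdI mean_marginal_in_measures_on)
  then have "\<mu>' \<in> product_measures 1 (n ^ d) (cube 1 k) (tv_nbhd (3 * \<epsilon>) (cube 1 k) \<Gamma>)"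
    by (auto simp: product_measures_def \<mu>'_def)
  moreover have "1 / real (n ^ d) ^ 1 * shannon \<mu>' = 1 / real n ^ d * shannon \<mu>"
    unfolding \<mu>'_def p entropy_rate_Pi_pmf[OF n1] entropy_rate_Pi_pmf[OF N1] law[symmetric] by simp
  ultimately show ?thesis by blast
qed

section \<open>Comparison of independence entropies\<close>

lemma h_ind_hat_le_axial_product:
  fixes \<Gamma> :: "(point \<Rightarrow> 'a::finite) pmf set"
  assumes "k \<ge> 1" "d \<ge> 1" "\<epsilon> > 0" "\<Gamma> \<subseteq> measures_on (cube 1 k)"
  shows "h_ind_hat 1 (cube 1 k) (tv_nbhd \<epsilon> (cube 1 k) \<Gamma>) \<le>
    h_ind_hat d (axial_window d k) (tv_nbhd (2 * real d * \<epsilon>) (axial_window d k) (axial_product d k \<Gamma>))"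
  unfolding h_ind_hat_def
proof (rule Limsup_mono, rule eventually_sequentiallyI[of k], rule SUP_mono)
  fix n \<mu> assume "k \<le> n" "\<mu> \<in> product_measures 1 n (cube 1 k) (tv_nbhd \<epsilon> (cube 1 k) \<Gamma>)"
  from exists_axial_product_measure[OF assms(1,2) this(1) assms(3,4) this(2)]
  show "\<exists>\<mu>'\<in>product_measures d n (axial_window d k)
      (tv_nbhd (2 * real d * \<epsilon>) (axial_window d k) (axial_product d k \<Gamma>)).
      ereal (1 / real n ^ 1 * shannon \<mu>) \<le> ereal (1 / real n ^ d * shannon \<mu>')"
    by (metis order_refl)
qed

text \<open>
  The bound at side \<open>n\<close> compares with a cycle of length \<open>n ^ d\<close>, and passing to the lengths that are
  \<open>d\<close>-th powers cannot increase the upper limit.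
\<close>

lemma h_ind_hat_axial_product_le:
  fixes \<Gamma> :: "(point \<Rightarrow> 'a::finite) pmf set"
  assumes k: "k \<ge> 1" and d: "d \<ge> 1" and \<epsilon>: "\<epsilon> > 0"
  shows "h_ind_hat d (axial_window d k) (tv_nbhd \<epsilon> (axial_window d k) (axial_product d k \<Gamma>)) \<le>
    h_ind_hat 1 (cube 1 k) (tv_nbhd (3 * \<epsilon>) (cube 1 k) \<Gamma>)"
proof -
  let ?a = "\<lambda>n. SUP \<mu>\<in>product_measures d n (axial_window d k)
      (tv_nbhd \<epsilon> (axial_window d k) (axial_product d k \<Gamma>)). ereal (1 / real n ^ d * shannon \<mu>)"
  let ?b = "\<lambda>n. SUP \<mu>\<in>product_measures 1 n (cube 1 k) (tv_nbhd (3 * \<epsilon>) (cube 1 k) \<Gamma>).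
      ereal (1 / real n ^ 1 * shannon \<mu>)"
  have "((\<lambda>n. real k / real n) \<longlongrightarrow> 0) sequentially"
    by (rule lim_const_over_n)
  then have "\<forall>\<^sub>F n in sequentially. real k / real n < \<epsilon>"
    using \<epsilon> by (rule order_tendstoD(2))
  then have "\<forall>\<^sub>F n in sequentially. ?a n \<le> (?b \<circ> (\<lambda>n. n ^ d)) n"
    using eventually_ge_at_top[of k]
  proof eventually_elim
    case (elim n)
    show ?case unfolding comp_def
    proof (rule SUP_mono)
      fix \<mu> assume "\<mu> \<in> product_measures d n (axial_window d k)
          (tv_nbhd \<epsilon> (axial_window d k) (axial_product d k \<Gamma>))"
      from exists_line_product_measure[OF k d elim(2) \<epsilon> less_imp_le[OF elim(1)] this]
      show "\<exists>\<mu>'\<in>product_measures 1 (n ^ d) (cube 1 k) (tv_nbhd (3 * \<epsilon>) (cube 1 k) \<Gamma>).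
          ereal (1 / real n ^ d * shannon \<mu>) \<le> ereal (1 / real (n ^ d) ^ 1 * shannon \<mu>')"
        by (metis order_refl)
    qed
  qed
  then have "limsup ?a \<le> limsup (?b \<circ> (\<lambda>n. n ^ d))"
    by (rule Limsup_mono)
  also have "strict_mono (\<lambda>n::nat. n ^ d)"
    using d by (intro strict_monoI power_strict_mono) auto
  then have "limsup (?b \<circ> (\<lambda>n. n ^ d)) \<le> limsup ?b"
    by (rule limsup_subseq_mono)
  finally show ?thesis unfolding h_ind_hat_def .
qed

lemma h_ind_le_h_ind_hat:
  assumes "\<epsilon> > 0"
  shows "h_ind d S \<Gamma> \<le> h_ind_hat d S (tv_nbhd \<epsilon> S \<Gamma>)"
proof (rule tendsto_upperbound[OF tendsto_h_ind])
  show "\<forall>\<^sub>F \<delta> in at_right 0. h_ind_hat d S (tv_nbhd \<delta> S \<Gamma>) \<le> h_ind_hat d S (tv_nbhd \<epsilon> S \<Gamma>)"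
    using assms by (auto simp: eventually_at_right_field intro!: exI[of _ \<epsilon>] h_ind_hat_mono tv_nbhd_mono)
qed simp

text \<open>
  The limit over the radius is an infimum, hence insensitive to rescaling the radius.
\<close>

lemma h_ind_mono_rescale:
  assumes c: "c > 0"
    and le: "\<And>\<epsilon>. \<epsilon> > 0 \<Longrightarrow> h_ind_hat d S (tv_nbhd \<epsilon> S \<Gamma>) \<le> h_ind_hat d' S' (tv_nbhd (c * \<epsilon>) S' \<Gamma>')"
  shows "h_ind d S \<Gamma> \<le> h_ind d' S' \<Gamma>'"
proof (rule tendsto_lowerbound[OF tendsto_h_ind])
  have "h_ind d S \<Gamma> \<le> h_ind_hat d' S' (tv_nbhd \<epsilon> S' \<Gamma>')" if "\<epsilon> > 0" for \<epsilon>
    using h_ind_le_h_ind_hat[of "\<epsilon> / c" d S \<Gamma>] le[of "\<epsilon> / c"] that c by (simp add: order_trans)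
  then show "\<forall>\<^sub>F \<epsilon> in at_right 0. h_ind d S \<Gamma> \<le> h_ind_hat d' S' (tv_nbhd \<epsilon> S' \<Gamma>')"
    by (auto simp: eventually_at_right_field intro!: exI[of _ 1])
qed simp

theorem theorem24:
  fixes k d :: nat
    and \<Gamma> :: "(point \<Rightarrow> 'a::finite) pmf set"
  assumes "k \<ge> 1"
    and "d \<ge> 1"
    and "\<Gamma> \<subseteq> measures_on (cube 1 k)"
  shows "h_ind d (axial_window d k) (axial_product d k \<Gamma>) = h_ind 1 (cube 1 k) \<Gamma>"
proof (rule antisym)
  show "h_ind d (axial_window d k) (axial_product d k \<Gamma>) \<le> h_ind 1 (cube 1 k) \<Gamma>"
    by (rule h_ind_mono_rescale[of 3]) (use h_ind_hat_axial_product_le assms in auto)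
  show "h_ind 1 (cube 1 k) \<Gamma> \<le> h_ind d (axial_window d k) (axial_product d k \<Gamma>)"
    by (rule h_ind_mono_rescale[of "2 * real d"]) (use h_ind_hat_le_axial_product assms in auto)
qed

end
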